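(* Consider the sim-to-real betting procedure (described in the context) with $K\ge1$ simulators with moments $(\mu_k,\sigma_k^2)$, learning rate $\eta>0$, $\kappa\in(0,1]$, $\delta\in(0,1)$, horizon $T$, run on i.i.d. real observations with mean $\mu^*$ and variance $\sigma^2$. Let $$v_{\min}=\min\{\sigma^2,\sigma_1^2,\dots,\sigma_K^2\},\qquad v_{\max}=\max\{\sigma^2,\sigma_1^2,\dots,\sigma_K^2\},$$ $$a_m=\frac{\kappa}{\delta v_{\min}},\qquad a_v=\frac{9\kappa}{16\sqrt3\,\delta v_{\min}^{3/2}},\qquad c_{\mathrm{stab}}=\sqrt{a_m^2+a_v^2},$$ $$b_{\mathrm{score}}=\frac12\log\frac{v_{\max}}{v_{\min}}+\frac{1}{2v_{\min}},\qquad c_{\mathrm{mom}}=2v_{\max}+4v_{\max}^2,$$ $$\epsilon_K=\min_{1\le k\le K}\frac12\Big[\log\Big(\frac{\sigma_k^2}{\sigma^2}\Big)+\frac{\sigma^2+(\mu^*-\mu_k)^2}{\sigma_k^2}-1\Big].$$ Then for every fixed round $t\in\{1,\dots,T\}$, the worst-candidate positive wealth regret $\overline{\mathcal{R}}_t$ satisfies $$\frac{\mathbb{E}\big[\overline{\mathcal{R}}_t\big]}{t}\ \le\ c_{\mathrm{stab}}\sqrt{c_{\mathrm{mom}}\Big(\epsilon_K+\frac{\log K}{\eta t}+\frac{\eta\, b_{\mathrm{score}}^2}{8}\Big)},$$ where the expectation is over the i.i.d. real stream from $P$.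
   Context: Real data: $P$ is a probability distribution on a measurable space $\mathcal{X}$, $\psi:\mathcal{X}\to[0,1]$ is measurable, $x_1,x_2,\dots$ are i.i.d. from $P$, $y_t=\psi(x_t)$, $\mu^*=\mathbb{E}[y_t]$, $\sigma^2=\mathbb{E}[(y_t-\mu^* )^2]>0$. Candidate means are $\mu\in\mathcal{M}=[0,1]$. Simulator bank: $K$ fixed (deterministic) pairs $(\mu_k,\sigma_k^2)$, with $\mu_k\in[0,1]$ and $\sigma_k^2>0$. Clipping: for a candidate $\mu$, $\mathrm{clip}_\delta$ truncates a real number to $\big[-\tfrac{1-\delta}{1-\mu},\tfrac{1-\delta}{\mu}\big]$ (an endpoint with zero denominator is read as $-\infty$, respectively $+\infty$). Sim-to-real betting procedure: $L_0^k=0$, $M_0(\mu)=1$. For $t=1,\dots,T$: $$\pi_t^k=\frac{\exp(\eta L_{t-1}^k)}{\sum_{j=1}^K\exp(\eta L_{t-1}^j)},\quad m_t=\sum_{k=1}^K\pi_t^k\mu_k,\quad v_t=\sum_{k=1}^K\pi_t^k\sigma_k^2,\quad \lambda_t(\mu)=\mathrm{clip}_\delta\Big\{\frac{\kappa(m_t-\mu)}{v_t+(m_t-\mu)^2}\Big\};$$ then $y_t$ is observed and $$M_t(\mu)=M_{t-1}(\mu)[1+\lambda_t(\mu)(y_t-\mu)],\qquad L_t^k=L_{t-1}^k+\log\mathcal{N}(y_t;\mu_k,\sigma_k^2),$$ where $\mathcal{N}(y;m,v)=(2\pi v)^{-1/2}\exp(-(y-m)^2/(2v))$. Ideal Kelly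 benchmark (same $\kappa,\delta$, same observations): $\lambda^*(\mu)=\mathrm{clip}_\delta\Big\{\frac{\kappa(\mu^*-\mu)}{\sigma^2+(\mu^*-\mu)^2}\Big\}$, $M_0^*(\mu)=1$, $M_t^*(\mu)=M_{t-1}^*(\mu)[1+\lambda^*(\mu)(y_t-\mu)]$. Wealth regret: $\mathcal{R}_t(\mu)=\log M_t^*(\mu)-\log M_t(\mu)$, $\mathcal{R}_t^+(\mu)=\max\{\mathcal{R}_t(\mu),0\}$, $\overline{\mathcal{R}}_t=\sup_{\mu\in\mathcal{M}}\mathcal{R}_t^+(\mu)$. *)

theory Defs
  imports "HOL-Probability.Probability"
begin

text \<open>
  Simulators are indexed by k in 1..K; ms k and vs k are the mean and the variance (not the
  standard deviation) of simulator k. Observations are a sequence y with rounds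
  1, 2, 3, ...; y 0 is never used.
\<close>

text \<open>Truncation to [-(1 - d) / (1 - mu), (1 - d) / mu] for mu in [0, 1], where the upper bound
  is absent for mu = 0 and the lower bound is absent for mu = 1.\<close>

definition clip :: "real \<Rightarrow> real \<Rightarrow> real \<Rightarrow> real" where
  "clip \<delta> \<mu> u =
     (let w = (if \<mu> = 0 then u else min u ((1 - \<delta>) / \<mu>))
      in if \<mu> = 1 then w else max w (- ((1 - \<delta>) / (1 - \<mu>))))"

definition bet_fraction :: "real \<Rightarrow> real \<Rightarrow> real \<Rightarrow> real \<Rightarrow> real \<Rightarrow> real" where
  "bet_fraction \<kappa> \<delta> m v \<mu> = clip \<delta> \<mu> (\<kappa> * (m - \<mu>) / (v + (m - \<mu>)\<^sup>2))"

primrec log_score :: "(nat \<Rightarrow> real) \<Rightarrow> (nat \<Rightarrow> real) \<Rightarrow> (nat \<Rightarrow> real) \<Rightarrow> nat \<Rightarrow> nat \<Rightarrow> real" where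
  "log_score ms vs y 0 k = 0"
| "log_score ms vs y (Suc t) k =
     log_score ms vs y t k + ln (normal_density (ms k) (sqrt (vs k)) (y (Suc t)))"

definition sim_weight ::
  "nat \<Rightarrow> (nat \<Rightarrow> real) \<Rightarrow> (nat \<Rightarrow> real) \<Rightarrow> real \<Rightarrow> (nat \<Rightarrow> real) \<Rightarrow> nat \<Rightarrow> nat \<Rightarrow> real" where
  "sim_weight K ms vs \<eta> y t k =
     exp (\<eta> * log_score ms vs y (t - 1) k) / (\<Sum>j=1..K. exp (\<eta> * log_score ms vs y (t - 1) j))"

definition mix_mean ::
  "nat \<Rightarrow> (nat \<Rightarrow> real) \<Rightarrow> (nat \<Rightarrow> real) \<Rightarrow> real \<Rightarrow> (nat \<Rightarrow> real) \<Rightarrow> nat \<Rightarrow> real" where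
  "mix_mean K ms vs \<eta> y t = (\<Sum>k=1..K. sim_weight K ms vs \<eta> y t k * ms k)"

definition mix_var ::
  "nat \<Rightarrow> (nat \<Rightarrow> real) \<Rightarrow> (nat \<Rightarrow> real) \<Rightarrow> real \<Rightarrow> (nat \<Rightarrow> real) \<Rightarrow> nat \<Rightarrow> real" where
  "mix_var K ms vs \<eta> y t = (\<Sum>k=1..K. sim_weight K ms vs \<eta> y t k * vs k)"

primrec wealth :: "(nat \<Rightarrow> real) \<Rightarrow> real \<Rightarrow> (nat \<Rightarrow> real) \<Rightarrow> nat \<Rightarrow> real" where
  "wealth bet \<mu> y 0 = 1"
| "wealth bet \<mu> y (Suc t) = wealth bet \<mu> y t * (1 + bet (Suc t) * (y (Suc t) - \<mu>))"

definition sim_wealth ::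
  "nat \<Rightarrow> (nat \<Rightarrow> real) \<Rightarrow> (nat \<Rightarrow> real) \<Rightarrow> real \<Rightarrow> real \<Rightarrow> real \<Rightarrow> (nat \<Rightarrow> real) \<Rightarrow> nat \<Rightarrow> real \<Rightarrow> real" where
  "sim_wealth K ms vs \<eta> \<kappa> \<delta> y t \<mu> =
     wealth (\<lambda>s. bet_fraction \<kappa> \<delta> (mix_mean K ms vs \<eta> y s) (mix_var K ms vs \<eta> y s) \<mu>) \<mu> y t"

definition kelly_wealth ::
  "real \<Rightarrow> real \<Rightarrow> real \<Rightarrow> real \<Rightarrow> (nat \<Rightarrow> real) \<Rightarrow> nat \<Rightarrow> real \<Rightarrow> real" where
  "kelly_wealth \<mu>\<^sub>0 \<sigma>2 \<kappa> \<delta> y t \<mu> = wealth (\<lambda>s. bet_fraction \<kappa> \<delta> \<mu>\<^sub>0 \<sigma>2 \<mu>) \<mu> y t"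

definition wealth_regret ::
  "nat \<Rightarrow> (nat \<Rightarrow> real) \<Rightarrow> (nat \<Rightarrow> real) \<Rightarrow> real \<Rightarrow> real \<Rightarrow> real \<Rightarrow> real \<Rightarrow> real \<Rightarrow> (nat \<Rightarrow> real)
    \<Rightarrow> nat \<Rightarrow> real \<Rightarrow> real" where
  "wealth_regret K ms vs \<eta> \<kappa> \<delta> \<mu>\<^sub>0 \<sigma>2 y t \<mu> =
     ln (kelly_wealth \<mu>\<^sub>0 \<sigma>2 \<kappa> \<delta> y t \<mu>) - ln (sim_wealth K ms vs \<eta> \<kappa> \<delta> y t \<mu>)"

definition pos_regret ::
  "nat \<Rightarrow> (nat \<Rightarrow> real) \<Rightarrow> (nat \<Rightarrow> real) \<Rightarrow> real \<Rightarrow> real \<Rightarrow> real \<Rightarrow> real \<Rightarrow> real \<Rightarrow> (nat \<Rightarrow> real)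
    \<Rightarrow> nat \<Rightarrow> real \<Rightarrow> real" where
  "pos_regret K ms vs \<eta> \<kappa> \<delta> \<mu>\<^sub>0 \<sigma>2 y t \<mu> = max (wealth_regret K ms vs \<eta> \<kappa> \<delta> \<mu>\<^sub>0 \<sigma>2 y t \<mu>) 0"

text \<open>A real-valued supremum, hence meaningful only when the positive regret is bounded over
  [0, 1].\<close>

definition worst_regret ::
  "nat \<Rightarrow> (nat \<Rightarrow> real) \<Rightarrow> (nat \<Rightarrow> real) \<Rightarrow> real \<Rightarrow> real \<Rightarrow> real \<Rightarrow> real \<Rightarrow> real \<Rightarrow> (nat \<Rightarrow> real)
    \<Rightarrow> nat \<Rightarrow> real" where
  "worst_regret K ms vs \<eta> \<kappa> \<delta> \<mu>\<^sub>0 \<sigma>2 y t =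
     (SUP \<mu>\<in>{0..1}. pos_regret K ms vs \<eta> \<kappa> \<delta> \<mu>\<^sub>0 \<sigma>2 y t \<mu>)"

definition v_min :: "nat \<Rightarrow> (nat \<Rightarrow> real) \<Rightarrow> real \<Rightarrow> real" where
  "v_min K vs \<sigma>2 = Min (insert \<sigma>2 (vs ` {1..K}))"

definition v_max :: "nat \<Rightarrow> (nat \<Rightarrow> real) \<Rightarrow> real \<Rightarrow> real" where
  "v_max K vs \<sigma>2 = Max (insert \<sigma>2 (vs ` {1..K}))"

definition c_stab :: "real \<Rightarrow> real \<Rightarrow> real \<Rightarrow> real" where
  "c_stab \<kappa> \<delta> vmin =
     (let a_m = \<kappa> / (\<delta> * vmin);
          a_v = 9 * \<kappa> / (16 * sqrt 3 * \<delta> * vmin powr (3 / 2))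
      in sqrt (a_m\<^sup>2 + a_v\<^sup>2))"

definition b_score :: "real \<Rightarrow> real \<Rightarrow> real" where
  "b_score vmin vmax = 1 / 2 * ln (vmax / vmin) + 1 / (2 * vmin)"

definition c_mom :: "real \<Rightarrow> real" where
  "c_mom vmax = 2 * vmax + 4 * vmax\<^sup>2"

definition eps_bank :: "nat \<Rightarrow> (nat \<Rightarrow> real) \<Rightarrow> (nat \<Rightarrow> real) \<Rightarrow> real \<Rightarrow> real \<Rightarrow> real" where
  "eps_bank K ms vs \<mu>\<^sub>0 \<sigma>2 =
     Min ((\<lambda>k. 1 / 2 * (ln (vs k / \<sigma>2) + (\<sigma>2 + (\<mu>\<^sub>0 - ms k)\<^sup>2) / vs k - 1)) ` {1..K})"

end

theory Submission
  imports Defs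
begin

text \<open>
  Both wealths grow by factors that clipping keeps above \<open>\<delta>\<close>, and the unclipped Kelly fraction
  is Lipschitz in the plug-in mean and variance, so the regret is at most \<open>c_stab\<close> times the sum
  over rounds of the Euclidean distance between plug-in and true moments. The square of that
  distance is at most \<open>c_mom\<close> times the posterior average of the Gaussian divergences from
  \<open>N(\<mu>\<^sub>0, \<sigma>2)\<close> to the simulators. The posterior is the exponential weights forecaster for the log
  scores, whose range over the bank is at most \<open>b_score\<close>; since the weights of a round are
  independent of its observation, and the expected log score of a simulator is a constant minus
  its divergence, the regret bound for exponential weights controls the expected cumulative
  posterior divergence by that of the best simulator. Two applications of Cauchy-Schwarz (over
  rounds and over the sample space) conclude.
\<close>

section \<open>Exponential weights\<close>

text \<open>On the point measure with weights \<open>p\<close>, the function \<open>g\<close> is a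
  random variable with values in \<open>[a, b]\<close>, so Hoeffding's lemma bounds the moment
  generating function of \<open>g\<close> centred at its mean \<open>e\<close>. Factoring out
  \<open>exp (\<eta> * e)\<close> undoes the centring.\<close>

lemma finite_Hoeffding_lemma:
  fixes p g :: "'a \<Rightarrow> real"
  assumes "finite A" "\<And>k. k \<in> A \<Longrightarrow> 0 \<le> p k" "sum p A = 1" "\<eta> > 0"
    and bounds: "\<And>k. k \<in> A \<Longrightarrow> a \<le> g k \<and> g k \<le> b"
  shows "(\<Sum>k\<in>A. p k * exp (\<eta> * g k)) \<le> exp (\<eta> * (\<Sum>k\<in>A. p k * g k) + \<eta>\<^sup>2 * (b - a)\<^sup>2 / 8)"
proof -
  define M where "M = point_measure A p"
  have "emeasure M (space M) = 1"
    using assms by (simp add: M_def space_point_measure emeasure_point_measure_finite)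
  then interpret prob_space M by (rule prob_spaceI)
  interpret interval_bounded_random_variable M g a b
    by unfold_locales
      (use bounds in \<open>auto simp: M_def space_point_measure intro!: AE_I2\<close>)
  define e where "e = (\<Sum>k\<in>A. p k * g k)"
  have e: "expectation g = e"
    using assms by (simp add: M_def e_def lebesgue_integral_point_measure_finite)
  have "ennreal (\<Sum>k\<in>A. p k * exp (\<eta> * (g k - e))) = (\<integral>\<^sup>+x. exp (\<eta> * (g x - e)) \<partial>M)"
    using assms
    by (simp add: M_def nn_integral_point_measure_finite ennreal_mult[symmetric] sum_ennreal mult.commute)
  also have "\<dots> \<le> ennreal (exp (\<eta>\<^sup>2 * (b - a)\<^sup>2 / 8))"
    using Hoeffdings_lemma_nn_integral[OF \<open>\<eta> > 0\<close>] by (simp add: e)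
  finally have *: "(\<Sum>k\<in>A. p k * exp (\<eta> * (g k - e))) \<le> exp (\<eta>\<^sup>2 * (b - a)\<^sup>2 / 8)"
    by (simp add: ennreal_le_iff)
  have "(\<Sum>k\<in>A. p k * exp (\<eta> * g k)) = exp (\<eta> * e) * (\<Sum>k\<in>A. p k * exp (\<eta> * (g k - e)))"
    by (simp add: sum_distrib_left exp_diff right_diff_distrib)
  also have "\<dots> \<le> exp (\<eta> * e) * exp (\<eta>\<^sup>2 * (b - a)\<^sup>2 / 8)"
    by (intro mult_left_mono *) simp
  finally show ?thesis by (simp add: exp_add e_def)
qed

text \<open>Potential argument with \<open>ln W\<close>, where \<open>W s\<close> is the total
  weight before round \<open>s\<close>. Each round raises the potential by at most \<eta> times the
  gain of the forecaster plus the Hoeffding term, while the final potential is at least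
  \<open>\<eta> * G t j\<close>, because a sum of positive terms dominates its term
  \<open>j\<close>.\<close>

lemma exponential_weights_gain:
  fixes g :: "nat \<Rightarrow> 'a \<Rightarrow> real"
  assumes "finite A" "j \<in> A" "\<eta> > 0"
    and range: "\<And>s i k. s < t \<Longrightarrow> i \<in> A \<Longrightarrow> k \<in> A \<Longrightarrow> g s i - g s k \<le> B"
  defines "G \<equiv> \<lambda>s k. \<Sum>r<s. g r k"
  shows "G t j - ln (card A) / \<eta> - \<eta> * B\<^sup>2 / 8 * real t
    \<le> (\<Sum>s<t. \<Sum>k\<in>A. exp (\<eta> * G s k) / (\<Sum>i\<in>A. exp (\<eta> * G s i)) * g s k)"
proof -
  define W where "W s = (\<Sum>i\<in>A. exp (\<eta> * G s i))" for s
  define m where "m s = (\<Sum>k\<in>A. exp (\<eta> * G s k) / W s * g s k)" for s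
  have A: "A \<noteq> {}" using assms by auto
  have W_pos: "W s > 0" for s unfolding W_def by (intro sum_pos assms A) simp
  have step: "ln (W (Suc s)) \<le> ln (W s) + \<eta> * m s + \<eta>\<^sup>2 * B\<^sup>2 / 8" if "s < t" for s
  proof -
    \<comment> \<open>The gains of different rounds may lie in different intervals. Only the length
      \<open>B\<close> enters Hoeffding's bound, so each round gets its own left end point
      \<open>a\<close>.\<close>
    define a where "a = Min (g s ` A)"
    have "a \<in> g s ` A" unfolding a_def using assms(1) A by (intro Min_in) auto
    then obtain i where i: "i \<in> A" "a = g s i" by auto
    have a: "a \<le> g s k \<and> g s k \<le> a + B" if "k \<in> A" for k
      using range[OF \<open>s < t\<close> \<open>k \<in> A\<close> i(1)] that assms(1) by (auto simp: i(2)[symmetric] a_def)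
    have "W (Suc s) = (\<Sum>k\<in>A. exp (\<eta> * G s k) * exp (\<eta> * g s k))"
      by (simp add: W_def G_def distrib_left exp_add)
    also have "\<dots> = W s * (\<Sum>k\<in>A. exp (\<eta> * G s k) / W s * exp (\<eta> * g s k))"
      using W_pos[of s] by (simp add: sum_distrib_left)
    also have "\<dots> \<le> W s * exp (\<eta> * m s + \<eta>\<^sup>2 * (a + B - a)\<^sup>2 / 8)"
      unfolding m_def using W_pos[of s] assms a
      by (intro mult_left_mono finite_Hoeffding_lemma)
        (auto simp: W_def sum_divide_distrib[symmetric])
    finally have "ln (W (Suc s)) \<le> ln (W s * exp (\<eta> * m s + \<eta>\<^sup>2 * B\<^sup>2 / 8))"
      using W_pos by (intro ln_mono) auto
    then show ?thesis using W_pos[of s] by (simp add: ln_mult)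
  qed
  have "ln (W s) \<le> ln (card A) + \<eta> * (\<Sum>r<s. m r) + \<eta>\<^sup>2 * B\<^sup>2 / 8 * s" if "s \<le> t" for s
    using that
  proof (induction s)
    case 0
    show ?case by (simp add: W_def G_def)
  next
    case (Suc s)
    then show ?case using step[of s] by (simp add: algebra_simps add_divide_distrib)
  qed
  from this[of t] have "ln (W t) \<le> ln (card A) + \<eta> * (\<Sum>r<t. m r) + \<eta>\<^sup>2 * B\<^sup>2 / 8 * t"
    by simp
  moreover have "exp (\<eta> * G t j) \<le> W t"
    unfolding W_def using assms(1,2) by (intro member_le_sum) auto
  then have "\<eta> * G t j \<le> ln (W t)" by (simp add: ln_ge_iff W_pos)
  ultimately have "\<eta> * (G t j - ln (card A) / \<eta> - \<eta> * B\<^sup>2 / 8 * real t) \<le> \<eta> * (\<Sum>s<t. m s)"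
    using \<open>\<eta> > 0\<close> by (simp add: algebra_simps power2_eq_square)
  then show ?thesis using \<open>\<eta> > 0\<close> by (simp add: m_def W_def)
qed

section \<open>Stability of the betting fraction\<close>

text \<open>Taking the minimum or the maximum with a constant is nonexpansive.\<close>

lemma clip_lipschitz: "\<bar>clip \<delta> \<mu> u - clip \<delta> \<mu> w\<bar> \<le> \<bar>u - w\<bar>"
  by (auto simp: clip_def Let_def min_def max_def abs_real_def)

text \<open>The factor is affine in \<open>y\<close>, so its extremes are at \<open>y = 0\<close>
  and \<open>y = 1\<close>. The upper clipping bound handles the first and the lower one the second,
  according to the sign of the bet.\<close>

lemma clip_wealth_factor:
  assumes "\<delta> \<in> {0<..<1}" "\<mu> \<in> {0..1}" "y \<in> {0..1}"
  shows "\<delta> \<le> 1 + clip \<delta> \<mu> u * (y - \<mu>)"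
proof -
  define c where "c = clip \<delta> \<mu> u"
  have up: "c * \<mu> \<le> 1 - \<delta>"
  proof (cases "\<mu> = 0")
    case False
    \<comment> \<open>In \<open>clip\<close> the maximum is taken after the minimum. The upper bound
      survives it because the two end points are separated by 0.\<close>
    then have "- ((1 - \<delta>) / (1 - \<mu>)) \<le> 0" "0 \<le> (1 - \<delta>) / \<mu>" using assms by auto
    then have "c \<le> (1 - \<delta>) / \<mu>" using False by (auto simp: c_def clip_def Let_def)
    then show ?thesis using False assms by (simp add: field_simps)
  qed (use assms in simp)
  have low: "- (1 - \<delta>) \<le> c * (1 - \<mu>)"
  proof (cases "\<mu> = 1")
    case False
    then have "- ((1 - \<delta>) / (1 - \<mu>)) \<le> c" by (auto simp: c_def clip_def Let_def)
    then show ?thesis using False assms by (simp add: field_simps)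
  qed (use assms in simp)
  have "- (1 - \<delta>) \<le> c * (y - \<mu>)"
  proof (cases "c \<ge> 0")
    case True
    then have "c * (y - \<mu>) \<ge> c * (- \<mu>)" using assms by (intro mult_left_mono) auto
    then show ?thesis using up by simp
  next
    case False
    then have "c * (y - \<mu>) \<ge> c * (1 - \<mu>)" using assms by (intro mult_left_mono_neg) auto
    then show ?thesis using low by simp
  qed
  then show ?thesis by (simp add: c_def)
qed

text \<open>The constant \<open>1 / v\<close> is the slope of \<open>d / (v + d\<^sup>2)\<close> at
  \<open>d = 0\<close>, where it is steepest. The proof works with the exact difference quotient
  \<open>(v - d * e) / ((v + d\<^sup>2) * (v + e\<^sup>2))\<close> and bounds it on both sides by
  completing squares.\<close>

lemma kelly_lipschitz_mean:
  fixes v d e :: real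
  assumes "v > 0"
  shows "\<bar>d / (v + d\<^sup>2) - e / (v + e\<^sup>2)\<bar> \<le> \<bar>d - e\<bar> / v"
proof -
  have pos: "v + d\<^sup>2 > 0" "v + e\<^sup>2 > 0" using assms by (auto intro: add_pos_nonneg)
  have "(v + d\<^sup>2) * (v + e\<^sup>2) - v * (v - d * e) = v * ((d + e / 2)\<^sup>2 + 3 / 4 * e\<^sup>2) + d\<^sup>2 * e\<^sup>2"
    by (simp add: power2_eq_square algebra_simps)
  moreover have "\<dots> \<ge> 0" using assms by (intro add_nonneg_nonneg mult_nonneg_nonneg) auto
  moreover have "(v + d\<^sup>2) * (v + e\<^sup>2) - v * (d * e - v)
      = 2 * v\<^sup>2 + v * ((d - e / 2)\<^sup>2 + 3 / 4 * e\<^sup>2) + d\<^sup>2 * e\<^sup>2"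
    by (simp add: power2_eq_square algebra_simps)
  moreover have "\<dots> \<ge> 0" using assms by (intro add_nonneg_nonneg mult_nonneg_nonneg) auto
  ultimately have "v * (v - d * e) \<le> (v + d\<^sup>2) * (v + e\<^sup>2)" "v * (d * e - v) \<le> (v + d\<^sup>2) * (v + e\<^sup>2)"
    by linarith+
  then have *: "v * \<bar>v - d * e\<bar> \<le> (v + d\<^sup>2) * (v + e\<^sup>2)" by (auto simp: abs_real_def)
  have "d / (v + d\<^sup>2) - e / (v + e\<^sup>2) = (d - e) * (v - d * e) / ((v + d\<^sup>2) * (v + e\<^sup>2))"
    using pos by (simp add: divide_simps) (simp add: power2_eq_square algebra_simps)
  then have "\<bar>d / (v + d\<^sup>2) - e / (v + e\<^sup>2)\<bar> = \<bar>d - e\<bar> * (\<bar>v - d * e\<bar> / ((v + d\<^sup>2) * (v + e\<^sup>2)))"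
    using pos by (simp add: abs_mult)
  also have "\<dots> \<le> \<bar>d - e\<bar> * (1 / v)"
  proof (intro mult_left_mono)
    have "P > 0 \<Longrightarrow> v * \<bar>v - d * e\<bar> \<le> P \<Longrightarrow> \<bar>v - d * e\<bar> / P \<le> 1 / v" for P
      using assms by (simp add: divide_simps mult.commute)
    then show "\<bar>v - d * e\<bar> / ((v + d\<^sup>2) * (v + e\<^sup>2)) \<le> 1 / v" using * pos by simp
  qed simp
  finally show ?thesis by simp
qed

lemma kelly_lipschitz_var_const:
  fixes a d :: real
  assumes "a > 0"
  shows "\<bar>d\<bar> / (a + d\<^sup>2)\<^sup>2 \<le> 9 / (16 * sqrt 3 * a powr (3 / 2))"
proof -
  \<comment> \<open>With \<open>u = sqrt a\<close> and \<open>z = sqrt 3 * \<bar>d\<bar>\<close> the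
    claim becomes the polynomial inequality
    \<open>16 * u ^ 3 * z \<le> (3 * u\<^sup>2 + z\<^sup>2)\<^sup>2\<close>.\<close>
  define u where "u = sqrt a"
  have u: "u > 0" "a = u\<^sup>2" using assms by (auto simp: u_def)
  have powr: "a powr (3 / 2) = u ^ 3"
    using u powr_powr[of u 2 "3 / 2"] by (simp add: powr_numeral)
  define z where "z = sqrt 3 * \<bar>d\<bar>"
  have z: "z \<ge> 0" "z\<^sup>2 = 3 * d\<^sup>2" by (auto simp: z_def power_mult_distrib)
  \<comment> \<open>\<open>\<bar>d\<bar> / (a + d\<^sup>2)\<^sup>2\<close> is maximal at \<open>3 d\<^sup>2 = a\<close>, that is \<open>z = u\<close>: a double root of the difference.\<close>
  have "(3 * u\<^sup>2 + z\<^sup>2)\<^sup>2 - 16 * u ^ 3 * z = (z - u)\<^sup>2 * (z\<^sup>2 + 2 * u * z + 9 * u\<^sup>2)"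
    by (simp add: power2_eq_square power3_eq_cube algebra_simps)
  also have "\<dots> \<ge> 0" using u z by (intro mult_nonneg_nonneg add_nonneg_nonneg) auto
  finally have "16 * u ^ 3 * z \<le> (3 * (u\<^sup>2 + d\<^sup>2))\<^sup>2" by (simp add: z(2))
  then have "16 * u ^ 3 * z \<le> 9 * (u\<^sup>2 + d\<^sup>2)\<^sup>2" by (simp only: power_mult_distrib) simp
  then have "\<bar>d\<bar> * (16 * sqrt 3 * u ^ 3) \<le> 9 * (a + d\<^sup>2)\<^sup>2"
    by (simp add: z_def u(2) mult_ac)
  moreover have "a + d\<^sup>2 > 0" using assms by (auto intro: add_pos_nonneg)
  ultimately show ?thesis using u(1) unfolding powr by (simp add: divide_simps mult_ac)
qed

text \<open>The difference quotient in the variance has absolute value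
  \<open>\<bar>d\<bar> / ((v + d\<^sup>2) * (w + d\<^sup>2))\<close>. Lowering both variances to
  \<open>a\<close> only increases it, and \<open>kelly_lipschitz_var_const\<close> maximises the
  result over \<open>d\<close>.\<close>

lemma kelly_lipschitz_var:
  fixes a d v w :: real
  assumes "a > 0" "a \<le> v" "a \<le> w"
  shows "\<bar>d / (v + d\<^sup>2) - d / (w + d\<^sup>2)\<bar> \<le> 9 / (16 * sqrt 3 * a powr (3 / 2)) * \<bar>v - w\<bar>"
proof -
  have pos: "a + d\<^sup>2 > 0" "v + d\<^sup>2 > 0" "w + d\<^sup>2 > 0" using assms by (auto intro!: add_pos_nonneg)
  have "d / (v + d\<^sup>2) - d / (w + d\<^sup>2) = d * (w - v) / ((v + d\<^sup>2) * (w + d\<^sup>2))"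
    using pos by (simp add: divide_simps) (simp add: algebra_simps)
  then have "\<bar>d / (v + d\<^sup>2) - d / (w + d\<^sup>2)\<bar> = \<bar>d\<bar> / ((v + d\<^sup>2) * (w + d\<^sup>2)) * \<bar>v - w\<bar>"
    using pos by (simp add: abs_mult abs_minus_commute)
  also have "\<dots> \<le> \<bar>d\<bar> / (a + d\<^sup>2)\<^sup>2 * \<bar>v - w\<bar>"
    using assms pos unfolding power2_eq_square[of "a + d\<^sup>2"]
    by (intro mult_right_mono divide_left_mono mult_mono) auto
  also have "\<dots> \<le> 9 / (16 * sqrt 3 * a powr (3 / 2)) * \<bar>v - w\<bar>"
    using kelly_lipschitz_var_const[OF assms(1)] by (intro mult_right_mono) auto
  finally show ?thesis .
qed

text \<open>After the nonexpansive clipping is removed, the path from \<open>(m, v)\<close> to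
  \<open>(n, w)\<close> goes through \<open>(n, v)\<close>: first the mean moves at fixed variance,
  then the variance at fixed mean.\<close>

lemma bet_fraction_lipschitz:
  assumes "\<kappa> > 0" "a > 0" "a \<le> v" "a \<le> w"
  shows "\<bar>bet_fraction \<kappa> \<delta> m v \<mu> - bet_fraction \<kappa> \<delta> n w \<mu>\<bar>
    \<le> \<kappa> / a * \<bar>m - n\<bar> + 9 * \<kappa> / (16 * sqrt 3 * a powr (3 / 2)) * \<bar>v - w\<bar>"
proof -
  define d e where "d = m - \<mu>" and "e = n - \<mu>"
  have "\<bar>bet_fraction \<kappa> \<delta> m v \<mu> - bet_fraction \<kappa> \<delta> n w \<mu>\<bar>
      \<le> \<bar>\<kappa> * d / (v + d\<^sup>2) - \<kappa> * e / (w + e\<^sup>2)\<bar>"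
    unfolding bet_fraction_def d_def e_def by (rule clip_lipschitz)
  also have "\<dots> = \<kappa> * \<bar>(d / (v + d\<^sup>2) - e / (v + e\<^sup>2)) + (e / (v + e\<^sup>2) - e / (w + e\<^sup>2))\<bar>"
    using \<open>\<kappa> > 0\<close> by (simp add: abs_mult flip: times_divide_eq_right right_diff_distrib)
  also have "\<dots> \<le> \<kappa> * (\<bar>d - e\<bar> / a + 9 / (16 * sqrt 3 * a powr (3 / 2)) * \<bar>v - w\<bar>)"
  proof (intro mult_left_mono order_trans[OF abs_triangle_ineq] add_mono)
    have "\<bar>d / (v + d\<^sup>2) - e / (v + e\<^sup>2)\<bar> \<le> \<bar>d - e\<bar> / v"
      using assms by (intro kelly_lipschitz_mean) auto
    also have "\<dots> \<le> \<bar>d - e\<bar> / a" using assms by (intro divide_left_mono) auto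
    finally show "\<bar>d / (v + d\<^sup>2) - e / (v + e\<^sup>2)\<bar> \<le> \<bar>d - e\<bar> / a" .
  qed (use assms kelly_lipschitz_var in auto)
  finally show ?thesis by (simp add: d_def e_def algebra_simps)
qed

lemma ln_diff_le_of_lower_bound:
  fixes p q \<delta> :: real
  assumes "0 < \<delta>" "\<delta> \<le> p" "\<delta> \<le> q"
  shows "ln p - ln q \<le> \<bar>p - q\<bar> / \<delta>"
proof -
  have "ln p - ln q \<le> (p - q) / q" using assms by (intro ln_diff_le) auto
  also have "\<dots> \<le> \<bar>p - q\<bar> / q" using assms by (intro divide_right_mono) auto
  also have "\<dots> \<le> \<bar>p - q\<bar> / \<delta>" using assms by (intro divide_left_mono) auto
  finally show ?thesis .
qed

lemma ln_wealth:
  assumes "\<And>s. s < t \<Longrightarrow> 0 < 1 + bet (Suc s) * (y (Suc s) - \<mu>)"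
  shows "ln (wealth bet \<mu> y t) = (\<Sum>s<t. ln (1 + bet (Suc s) * (y (Suc s) - \<mu>)))"
proof -
  have "wealth bet \<mu> y t = (\<Prod>s<t. 1 + bet (Suc s) * (y (Suc s) - \<mu>))"
    by (induction t) auto
  then have "ln (wealth bet \<mu> y t) = ln (\<Prod>s<t. 1 + bet (Suc s) * (y (Suc s) - \<mu>))"
    by simp
  also have "\<dots> = (\<Sum>s<t. ln (1 + bet (Suc s) * (y (Suc s) - \<mu>)))"
    by (rule ln_prod) (use assms in \<open>auto simp: less_imp_neq[symmetric]\<close>)
  finally show ?thesis .
qed

lemma c_stab_nonneg: "0 \<le> c_stab \<kappa> \<delta> a"
  by (simp add: c_stab_def Let_def)

text \<open>Both factors are at least \<delta>, where \<open>ln\<close> has Lipschitz constant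
  \<open>1 / \<delta>\<close>, and \<open>\<bar>y - \<mu>\<bar> \<le> 1\<close>, so the Lipschitz
  bound for the bets applies. Cauchy-Schwarz in the plane then turns the two separate slopes into
  \<open>c_stab\<close>, the Euclidean norm of \<open>(am, av)\<close>.\<close>

lemma log_factor_diff_le:
  assumes "\<kappa> > 0" "\<delta> \<in> {0<..<1}" "a > 0" "a \<le> v" "a \<le> w" "\<mu> \<in> {0..1}" "y \<in> {0..1}"
  shows "ln (1 + bet_fraction \<kappa> \<delta> n w \<mu> * (y - \<mu>)) - ln (1 + bet_fraction \<kappa> \<delta> m v \<mu> * (y - \<mu>))
    \<le> c_stab \<kappa> \<delta> a * sqrt ((m - n)\<^sup>2 + (v - w)\<^sup>2)"
proof -
  define b c where "b = bet_fraction \<kappa> \<delta> n w \<mu>" and "c = bet_fraction \<kappa> \<delta> m v \<mu>"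
  define am av where "am = \<kappa> / (\<delta> * a)" and "av = 9 * \<kappa> / (16 * sqrt 3 * \<delta> * a powr (3 / 2))"
  have "ln (1 + b * (y - \<mu>)) - ln (1 + c * (y - \<mu>)) \<le> \<bar>(1 + b * (y - \<mu>)) - (1 + c * (y - \<mu>))\<bar> / \<delta>"
    unfolding b_def c_def bet_fraction_def using assms
    by (intro ln_diff_le_of_lower_bound clip_wealth_factor) auto
  also have "\<dots> = \<bar>c - b\<bar> * \<bar>y - \<mu>\<bar> / \<delta>"
    by (simp add: abs_mult abs_minus_commute flip: left_diff_distrib)
  also have "\<dots> \<le> \<bar>c - b\<bar> / \<delta>"
    using assms mult_left_le[of "\<bar>y - \<mu>\<bar>" "\<bar>c - b\<bar>"] by (intro divide_right_mono) auto
  also have "\<dots> \<le> (\<kappa> / a * \<bar>m - n\<bar> + 9 * \<kappa> / (16 * sqrt 3 * a powr (3 / 2)) * \<bar>v - w\<bar>) / \<delta>"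
    unfolding b_def c_def using assms by (intro divide_right_mono bet_fraction_lipschitz) auto
  also have "\<dots> = am * \<bar>m - n\<bar> + av * \<bar>v - w\<bar>"
    using assms by (simp add: am_def av_def add_divide_distrib mult_ac)
  also have "\<dots> \<le> sqrt ((am\<^sup>2 + av\<^sup>2) * ((m - n)\<^sup>2 + (v - w)\<^sup>2))"
  proof (rule real_le_rsqrt)
    define p q where "p = \<bar>m - n\<bar>" and "q = \<bar>v - w\<bar>"
    have "(am\<^sup>2 + av\<^sup>2) * (p\<^sup>2 + q\<^sup>2) - (am * p + av * q)\<^sup>2 = (am * q - av * p)\<^sup>2"
      by (simp add: power2_eq_square algebra_simps)
    then have "(am * p + av * q)\<^sup>2 \<le> (am\<^sup>2 + av\<^sup>2) * (p\<^sup>2 + q\<^sup>2)"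
      by (smt (verit) zero_le_power2)
    then show "(am * \<bar>m - n\<bar> + av * \<bar>v - w\<bar>)\<^sup>2 \<le> (am\<^sup>2 + av\<^sup>2) * ((m - n)\<^sup>2 + (v - w)\<^sup>2)"
      by (simp add: p_def q_def)
  qed
  finally show ?thesis
    by (simp add: b_def c_def am_def av_def c_stab_def Let_def real_sqrt_mult)
qed

text \<open>The right-hand side is free of the candidate \<mu>, so the supremum over candidates will
  cost nothing.\<close>

lemma wealth_regret_le:
  assumes "\<kappa> > 0" "\<delta> \<in> {0<..<1}" "a > 0" "\<mu> \<in> {0..1}" "a \<le> \<sigma>2"
    and "\<And>s. s < t \<Longrightarrow> y (Suc s) \<in> {0..1}"
    and "\<And>s. s < t \<Longrightarrow> a \<le> mix_var K ms vs \<eta> y (Suc s)"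
  shows "wealth_regret K ms vs \<eta> \<kappa> \<delta> \<mu>\<^sub>0 \<sigma>2 y t \<mu>
    \<le> (\<Sum>s<t. c_stab \<kappa> \<delta> a * sqrt ((mix_mean K ms vs \<eta> y (Suc s) - \<mu>\<^sub>0)\<^sup>2
                                  + (mix_var K ms vs \<eta> y (Suc s) - \<sigma>2)\<^sup>2))"
proof -
  have pos: "0 < 1 + bet_fraction \<kappa> \<delta> m v \<mu> * (y (Suc s) - \<mu>)" if "s < t" for m v s
    using clip_wealth_factor[OF assms(2,4) assms(6)[OF that]] assms(2)
    by (force simp: bet_fraction_def intro: less_le_trans)
  show ?thesis
    unfolding wealth_regret_def kelly_wealth_def sim_wealth_def
    by (subst (1 2) ln_wealth)
      (use assms pos in \<open>auto simp: sum_subtractf[symmetric] intro!: sum_mono log_factor_diff_le\<close>)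
qed

section \<open>Gaussian divergence and moment errors\<close>

text \<open>The difference \<open>h\<close> of the two sides vanishes at 1 and is nonincreasing on
  \<open>(0, 1]\<close>. This serves the case where the simulator variance \<open>v\<close> is the
  larger one, with \<open>r = w / v\<close>.\<close>

lemma ln_quadratic_bound:
  fixes r :: real
  assumes "0 < r" "r \<le> 1"
  shows "(1 - r)\<^sup>2 / 2 \<le> r - 1 - ln r"
proof -
  define h where "h x = x - 1 - ln x - (1 - x)\<^sup>2 / 2" for x :: real
  have "h 1 \<le> h r"
  proof (rule DERIV_nonpos_imp_nonincreasing[OF \<open>r \<le> 1\<close>])
    fix x assume x: "r \<le> x" "x \<le> 1"
    have "(h has_real_derivative (1 - x) * (1 - 1 / x)) (at x)"
      unfolding h_def[abs_def] using assms x
      by (auto intro!: derivative_eq_intros simp: field_simps)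
    moreover have "(1 - x) * (1 - 1 / x) \<le> 0"
      using assms x by (intro mult_nonneg_nonpos) (auto simp: field_simps)
    ultimately show "\<exists>D. (h has_real_derivative D) (at x) \<and> D \<le> 0" by blast
  qed
  then show ?thesis by (simp add: h_def)
qed

text \<open>The counterpart for the case where the true variance \<open>w\<close> is the larger one,
  with \<open>r = v / w\<close>; the same monotonicity argument applies.\<close>

lemma ln_quadratic_bound_inverse:
  fixes r :: real
  assumes "0 < r" "r \<le> 1"
  shows "(1 - r)\<^sup>2 / 2 \<le> 1 / r - 1 + ln r"
proof -
  define h where "h x = 1 / x - 1 + ln x - (1 - x)\<^sup>2 / 2" for x :: real
  have "h 1 \<le> h r"
  proof (rule DERIV_nonpos_imp_nonincreasing[OF \<open>r \<le> 1\<close>])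
    fix x assume x: "r \<le> x" "x \<le> 1"
    have "(h has_real_derivative (1 - x) * (1 - 1 / x\<^sup>2)) (at x)"
      unfolding h_def[abs_def] using assms x
      by (auto intro!: derivative_eq_intros simp: field_simps power2_eq_square)
    moreover have "(1 - x) * (1 - 1 / x\<^sup>2) \<le> 0"
      using assms x by (intro mult_nonneg_nonpos) (auto simp: field_simps power_le_one)
    ultimately show "\<exists>D. (h has_real_derivative D) (at x) \<and> D \<le> 0" by blast
  qed
  then show ?thesis by (simp add: h_def)
qed

text \<open>KL(N(\<open>\<mu>\<close>, w) || N(m, v)).\<close>

definition gauss_kl :: "real \<Rightarrow> real \<Rightarrow> real \<Rightarrow> real \<Rightarrow> real" where
  "gauss_kl \<mu> w m v = 1 / 2 * (ln (v / w) + (w + (\<mu> - m)\<^sup>2) / v - 1)"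

text \<open>The last factor is twice the divergence of two Gaussians with equal means and variances
  \<open>w\<close> and \<open>v\<close>. Scaling by the larger variance keeps the ratio in
  \<open>(0, 1]\<close>, where the quadratic bounds hold.\<close>

lemma variance_diff_le:
  fixes v w V :: real
  assumes "0 < v" "v \<le> V" "0 < w" "w \<le> V"
  shows "(v - w)\<^sup>2 \<le> 2 * V\<^sup>2 * (w / v - 1 + ln (v / w))"
proof -
  \<comment> \<open>Here \<open>q\<close> is to be the larger of the two variances and
    \<open>r\<close> the ratio of the smaller to the larger, so that
    \<open>\<bar>v - w\<bar> = q * (1 - r)\<close>.\<close>
  have *: "(v - w)\<^sup>2 \<le> 2 * V\<^sup>2 * e"
    if "q \<in> {v, w}" "(v - w)\<^sup>2 = q\<^sup>2 * (1 - r)\<^sup>2" "(1 - r)\<^sup>2 / 2 \<le> e" for q r e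
  proof -
    have "q\<^sup>2 * (1 - r)\<^sup>2 \<le> V\<^sup>2 * (2 * e)"
      using that assms by (intro mult_mono power_mono) auto
    then show ?thesis using that by simp
  qed
  show ?thesis
  proof (cases "w \<le> v")
    case True
    show ?thesis
      by (rule *[of v "w / v"])
        (use assms True ln_quadratic_bound[of "w / v"] in
          \<open>auto simp: ln_div power_mult_distrib[symmetric] right_diff_distrib\<close>)
  next
    case False
    show ?thesis
      by (rule *[of w "v / w"])
        (use assms False ln_quadratic_bound_inverse[of "v / w"] in
          \<open>auto simp: power_mult_distrib[symmetric] right_diff_distrib power2_commute\<close>)
  qed
qed

text \<open>The divergence splits into a mean part \<open>a\<close> and a variance part
  \<open>b\<close>. The former controls the squared mean error with constant \<open>2 * V\<close>,
  the latter the squared variance error with constant \<open>4 * V\<^sup>2\<close>. Both parts are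
  nonnegative, so the sum of the constants, \<open>c_mom V\<close>, works for the sum of the
  errors.\<close>

lemma moment_error_le_gauss_kl:
  assumes "0 < v" "v \<le> V" "0 < w" "w \<le> V"
  shows "(m - \<mu>)\<^sup>2 + (v - w)\<^sup>2 \<le> c_mom V * gauss_kl \<mu> w m v"
proof -
  define a b where "a = (\<mu> - m)\<^sup>2 / (2 * v)" and "b = (w / v - 1 + ln (v / w)) / 2"
  have V: "V > 0" using assms by simp
  have "(v - w)\<^sup>2 \<le> 4 * V\<^sup>2 * b" using variance_diff_le[OF assms] by (simp add: b_def)
  moreover from this have "b \<ge> 0"
    using V by (smt (verit) mult_pos_neg zero_le_power2 zero_less_power2)
  moreover have "a \<ge> 0" using assms by (simp add: a_def)
  moreover have "(m - \<mu>)\<^sup>2 \<le> 2 * V * a"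
  proof -
    have "2 * v * a \<le> 2 * V * a" using assms \<open>a \<ge> 0\<close> by (intro mult_right_mono) auto
    then show ?thesis using assms by (simp add: a_def power2_commute)
  qed
  moreover have "0 \<le> 4 * V\<^sup>2 * a" "0 \<le> 2 * V * b" using \<open>a \<ge> 0\<close> \<open>b \<ge> 0\<close> V by auto
  moreover have "gauss_kl \<mu> w m v = a + b"
    by (simp add: gauss_kl_def a_def b_def add_divide_distrib diff_divide_distrib)
  then have "c_mom V * gauss_kl \<mu> w m v = 2 * V * a + 4 * V\<^sup>2 * b + 4 * V\<^sup>2 * a + 2 * V * b"
    by (simp add: c_mom_def algebra_simps)
  ultimately show ?thesis by linarith
qed

text \<open>A positive multiple of the divergence dominates a sum of squares.\<close>

lemma gauss_kl_nonneg:
  assumes "0 < v" "0 < w"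
  shows "0 \<le> gauss_kl \<mu> w m v"
proof -
  define V where "V = max v w"
  have "c_mom V > 0" using assms by (simp add: c_mom_def V_def add_pos_pos)
  moreover have "0 \<le> c_mom V * gauss_kl \<mu> w m v"
    by (rule order_trans[OF _ moment_error_le_gauss_kl])
      (use assms in \<open>auto simp: V_def\<close>)
  ultimately show ?thesis by (simp add: zero_le_mult_iff)
qed

text \<open>Jensen's inequality for the square.\<close>

lemma weighted_mean_diff_square_le:
  fixes p f :: "'a \<Rightarrow> real"
  assumes "finite A" "\<And>k. k \<in> A \<Longrightarrow> 0 \<le> p k" "sum p A = 1"
  shows "((\<Sum>k\<in>A. p k * f k) - c)\<^sup>2 \<le> (\<Sum>k\<in>A. p k * (f k - c)\<^sup>2)"
proof -
  have "(\<Sum>k\<in>A. p k * f k) - c = (\<Sum>k\<in>A. p k *\<^sub>R (f k - c))"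
    using assms by (simp add: right_diff_distrib sum_subtractf flip: sum_distrib_right)
  moreover have "A \<noteq> {}" using assms by auto
  ultimately show ?thesis
    using convex_on_sum[OF assms(1) _ convex_power2 assms(3,2), of "\<lambda>k. f k - c"] by simp
qed

section \<open>Gaussian log scores and the posterior weights\<close>

lemma ln_normal_density:
  assumes "v > 0"
  shows "ln (normal_density m (sqrt v) y) = - ln (2 * pi * v) / 2 - (y - m)\<^sup>2 / (2 * v)"
  using assms by (simp add: normal_density_def ln_mult ln_div ln_sqrt real_sqrt_mult)

lemma log_score_eq_sum:
  "log_score ms vs y t k = (\<Sum>s<t. ln (normal_density (ms k) (sqrt (vs k)) (y (Suc s))))"
  by (induction t) auto

text \<open>The normalising constants differ by at most half of \<open>ln (b / a)\<close>. Each
  quadratic term is nonnegative, and the one for \<open>m\<close> is at most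
  \<open>1 / (2 * a)\<close>, since \<open>m\<close> and \<open>y\<close> both lie in the unit
  interval.\<close>

lemma ln_normal_density_range:
  assumes "0 < a" "a \<le> v" "v \<le> b" "a \<le> w" "w \<le> b" "m \<in> {0..1}" "y \<in> {0..1}"
  shows "ln (normal_density n (sqrt v) y) - ln (normal_density m (sqrt w) y) \<le> b_score a b"
proof -
  have "(y - m)\<^sup>2 / (2 * w) \<le> 1 / (2 * a)"
    using assms by (intro frac_le) (auto simp: abs_square_le_1)
  moreover have "0 \<le> (y - n)\<^sup>2 / (2 * v)" using assms by simp
  moreover have "ln (2 * pi * w) - ln (2 * pi * v) \<le> ln (b / a)"
  proof -
    have "ln a \<le> ln v" "ln w \<le> ln b" using assms by (auto intro: ln_mono)
    moreover have "ln (2 * pi * w) - ln (2 * pi * v) = ln w - ln v" "ln (b / a) = ln b - ln a"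
      using assms by (simp_all add: ln_mult ln_div)
    ultimately show ?thesis by linarith
  qed
  moreover have "0 < v" "0 < w" using assms by auto
  ultimately show ?thesis
    unfolding b_score_def by (simp only: ln_normal_density)
qed

lemma sim_weight_nonneg: "0 \<le> sim_weight K ms vs \<eta> y s k"
  by (simp add: sim_weight_def sum_nonneg)

lemma sim_weight_sum:
  assumes "K \<ge> 1"
  shows "(\<Sum>k=1..K. sim_weight K ms vs \<eta> y s k) = 1"
proof -
  have "(\<Sum>j=1..K. exp (\<eta> * log_score ms vs y (s - 1) j)) > 0"
    using assms by (intro sum_pos) auto
  then show ?thesis by (simp add: sim_weight_def flip: sum_divide_distrib)
qed

lemma sim_weight_le_1:
  assumes "k \<in> {1..K}"
  shows "sim_weight K ms vs \<eta> y s k \<le> 1"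
proof -
  have "sim_weight K ms vs \<eta> y s k \<le> (\<Sum>j=1..K. sim_weight K ms vs \<eta> y s j)"
    by (rule member_le_sum) (use assms in \<open>auto simp: sim_weight_nonneg\<close>)
  then show ?thesis using assms by (subst (asm) sim_weight_sum) auto
qed

lemma mix_var_ge:
  assumes "K \<ge> 1" "\<And>k. k \<in> {1..K} \<Longrightarrow> a \<le> vs k"
  shows "a \<le> mix_var K ms vs \<eta> y s"
proof -
  have "a = (\<Sum>k=1..K. sim_weight K ms vs \<eta> y s k * a)"
    using sim_weight_sum[OF assms(1)] by (simp flip: sum_distrib_right)
  also have "\<dots> \<le> mix_var K ms vs \<eta> y s"
    unfolding mix_var_def using assms by (intro sum_mono mult_left_mono) (auto simp: sim_weight_nonneg)
  finally show ?thesis .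
qed

text \<open>Jensen replaces the error of the mixed moments by the posterior average of the errors of
  the single simulators, to each of which the divergence bound applies.\<close>

lemma mixture_error_le:
  assumes "K \<ge> 1" "\<And>k. k \<in> {1..K} \<Longrightarrow> 0 < vs k" "\<And>k. k \<in> {1..K} \<Longrightarrow> vs k \<le> V" "0 < w" "w \<le> V"
  shows "(mix_mean K ms vs \<eta> y s - \<mu>)\<^sup>2 + (mix_var K ms vs \<eta> y s - w)\<^sup>2
    \<le> c_mom V * (\<Sum>k=1..K. sim_weight K ms vs \<eta> y s k * gauss_kl \<mu> w (ms k) (vs k))"
proof -
  let ?p = "sim_weight K ms vs \<eta> y s"
  have "(mix_mean K ms vs \<eta> y s - \<mu>)\<^sup>2 + (mix_var K ms vs \<eta> y s - w)\<^sup>2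
      \<le> (\<Sum>k=1..K. ?p k * (ms k - \<mu>)\<^sup>2) + (\<Sum>k=1..K. ?p k * (vs k - w)\<^sup>2)"
    unfolding mix_mean_def mix_var_def using assms
    by (intro add_mono weighted_mean_diff_square_le) (auto simp: sim_weight_nonneg sim_weight_sum[simplified])
  also have "\<dots> = (\<Sum>k=1..K. ?p k * ((ms k - \<mu>)\<^sup>2 + (vs k - w)\<^sup>2))"
    by (simp add: distrib_left sum.distrib)
  also have "\<dots> \<le> (\<Sum>k=1..K. ?p k * (c_mom V * gauss_kl \<mu> w (ms k) (vs k)))"
    using assms by (intro sum_mono mult_left_mono moment_error_le_gauss_kl) (auto simp: sim_weight_nonneg)
  finally show ?thesis by (simp add: sum_distrib_left mult_ac)
qed

text \<open>The weights of round \<open>Suc s\<close> are built from the scores after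
  \<open>s\<close> rounds, which are the partial sums \<open>G s\<close> of the abstract forecaster.
  The range \<open>B\<close> becomes \<open>b_score a b\<close>.\<close>

lemma sim_weight_gain:
  fixes ms vs :: "nat \<Rightarrow> real"
  assumes "\<eta> > 0" "j \<in> {1..K}" "0 < a"
    and "\<And>k. k \<in> {1..K} \<Longrightarrow> vs k \<in> {a..b}" "\<And>k. k \<in> {1..K} \<Longrightarrow> ms k \<in> {0..1}"
    and "\<And>s. s < t \<Longrightarrow> y (Suc s) \<in> {0..1}"
  defines "l \<equiv> \<lambda>s k. ln (normal_density (ms k) (sqrt (vs k)) (y (Suc s)))"
  shows "(\<Sum>s<t. l s j) - ln K / \<eta> - \<eta> * (b_score a b)\<^sup>2 / 8 * t
    \<le> (\<Sum>s<t. \<Sum>k=1..K. sim_weight K ms vs \<eta> y (Suc s) k * l s k)"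
  using exponential_weights_gain[of "{1..K}" j \<eta> t l "b_score a b"] assms(1-6)
  by (simp add: sim_weight_def log_score_eq_sum l_def ln_normal_density_range)

section \<open>Continuity in the candidate mean\<close>

lemma clip_eq:
  assumes "\<mu> \<in> {0<..<1}"
  shows "clip \<delta> \<mu> u = max (min u ((1 - \<delta>) / \<mu>)) (- ((1 - \<delta>) / (1 - \<mu>)))"
  using assms by (auto simp: clip_def Let_def)

lemma continuous_on_bet_fraction:
  assumes "v > 0"
  shows "continuous_on {0<..<1} (bet_fraction \<kappa> \<delta> m v)"
proof -
  have "v + (m - \<mu>)\<^sup>2 \<noteq> 0" for \<mu>
    using assms by (smt (verit) zero_le_power2)
  then have "continuous_on {0<..<1} (\<lambda>\<mu>.
      max (min (\<kappa> * (m - \<mu>) / (v + (m - \<mu>)\<^sup>2)) ((1 - \<delta>) / \<mu>)) (- ((1 - \<delta>) / (1 - \<mu>))))"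
    by (intro continuous_intros) auto
  then show ?thesis
    by (rule continuous_on_eq) (simp add: bet_fraction_def clip_eq)
qed

lemma continuous_on_ln_wealth:
  assumes "\<delta> \<in> {0<..<1}" "\<And>s. s < t \<Longrightarrow> y (Suc s) \<in> {0..1}" "\<And>s. s < t \<Longrightarrow> 0 < v (Suc s)"
  shows "continuous_on {0<..<1} (\<lambda>\<mu>. ln (wealth (\<lambda>s. bet_fraction \<kappa> \<delta> (m s) (v s) \<mu>) \<mu> y t))"
proof -
  have pos: "0 < 1 + bet_fraction \<kappa> \<delta> (m (Suc s)) (v (Suc s)) \<mu> * (y (Suc s) - \<mu>)"
    if "s < t" "\<mu> \<in> {0<..<1}" for s \<mu>
    using clip_wealth_factor[of \<delta> \<mu> "y (Suc s)"] assms that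
    by (force simp: bet_fraction_def intro: less_le_trans)
  have "continuous_on {0<..<1}
      (\<lambda>\<mu>. \<Sum>s<t. ln (1 + bet_fraction \<kappa> \<delta> (m (Suc s)) (v (Suc s)) \<mu> * (y (Suc s) - \<mu>)))"
    using pos assms
    by (intro continuous_intros continuous_on_bet_fraction) (auto simp: less_imp_neq[symmetric])
  then show ?thesis
    by (rule continuous_on_eq) (simp add: ln_wealth pos)
qed

text \<open>Makes the supremum over candidates measurable. No continuity at the end points, where
  \<open>clip\<close> changes its form, is needed because they are rational.\<close>

lemma SUP_unit_interval_rational:
  fixes f :: "real \<Rightarrow> real"
  assumes "continuous_on {0<..<1} f" "bdd_above (f ` {0..1})"
  shows "(SUP \<mu>\<in>{0..1}. f \<mu>) = (SUP \<mu>\<in>\<rat> \<inter> {0..1}. f \<mu>)"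
proof (rule antisym)
  have bdd: "bdd_above (f ` (\<rat> \<inter> {0..1}))"
    using assms(2) by (rule bdd_above_mono) auto
  show "(SUP \<mu>\<in>\<rat> \<inter> {0..1}. f \<mu>) \<le> (SUP \<mu>\<in>{0..1}. f \<mu>)"
    by (intro cSUP_subset_mono assms(2)) (auto intro: exI[of _ 0])
  show "(SUP \<mu>\<in>{0..1}. f \<mu>) \<le> (SUP \<mu>\<in>\<rat> \<inter> {0..1}. f \<mu>)"
  proof (rule cSUP_least)
    fix \<mu> :: real assume "\<mu> \<in> {0..1}"
    then consider "\<mu> \<in> \<rat>" | "\<mu> \<in> {0<..<1}" by fastforce
    then show "f \<mu> \<le> (SUP \<mu>\<in>\<rat> \<inter> {0..1}. f \<mu>)"
    proof cases
      case 1
      then show ?thesis using \<open>\<mu> \<in> {0..1}\<close> by (intro cSUP_upper bdd) auto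
    next
      case 2
      let ?S = "SUP \<mu>\<in>\<rat> \<inter> {0..1}. f \<mu>"
      show ?thesis
      proof (rule ccontr)
        assume "\<not> f \<mu> \<le> ?S"
        \<comment> \<open>If \<open>f \<mu>\<close> exceeded the rational supremum, continuity would
          extend the excess to a neighbourhood of \<mu>, which contains a rational
          \<open>q\<close>.\<close>
        moreover have "open (f -` {?S<..} \<inter> {0<..<1})"
          using assms(1) by (auto simp: continuous_on_open_vimage)
        ultimately obtain e where e: "e > 0" "\<And>x. dist x \<mu> < e \<Longrightarrow> ?S < f x \<and> x \<in> {0<..<1}"
          using 2 unfolding open_dist by fastforce
        obtain q where "q \<in> \<rat>" "\<mu> < q" "q < \<mu> + e"
          using Rats_dense_in_real[of \<mu> "\<mu> + e"] e(1) by auto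
        moreover from this have "?S < f q" "q \<in> {0<..<1}"
          using e(2)[of q] by (auto simp: dist_real_def)
        ultimately show False
          using cSUP_upper[OF _ bdd, of q] by auto
      qed
    qed
  qed auto
qed

section \<open>The random stream\<close>

lemma borel_measurable_log_score:
  assumes "\<And>i. i \<in> {1..n} \<Longrightarrow> (\<lambda>\<omega>. y \<omega> i) \<in> borel_measurable M"
  shows "(\<lambda>\<omega>. log_score ms vs (y \<omega>) n k) \<in> borel_measurable M"
proof -
  have [measurable]: "(\<lambda>\<omega>. y \<omega> (Suc s)) \<in> borel_measurable M" if "s \<in> {..<n}" for s
    using that by (intro assms) auto
  show ?thesis unfolding log_score_eq_sum by measurable
qed

text \<open>Asking for measurability of rounds 1 to \<open>n\<close> alone lets the lemma serve two
  spaces: the sample space and the finite product over past rounds used in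
  \<open>indep_weight_y\<close>.\<close>

lemma borel_measurable_sim_weight:
  assumes "\<And>i. i \<in> {1..n} \<Longrightarrow> (\<lambda>\<omega>. y \<omega> i) \<in> borel_measurable M"
  shows "(\<lambda>\<omega>. sim_weight K ms vs \<eta> (y \<omega>) (Suc n) k) \<in> borel_measurable M"
proof -
  note [measurable] = borel_measurable_log_score[OF assms]
  show ?thesis unfolding sim_weight_def diff_Suc_1 by measurable
qed

text \<open>Predictability: the weights of round \<open>Suc n\<close> are a function of the first
  \<open>n\<close> observations.\<close>

lemma sim_weight_cong:
  assumes "\<And>i. i \<in> {1..n} \<Longrightarrow> y i = z i"
  shows "sim_weight K ms vs \<eta> y (Suc n) k = sim_weight K ms vs \<eta> z (Suc n) k"
  using assms by (simp add: sim_weight_def log_score_eq_sum)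

lemma borel_measurable_wealth:
  assumes [measurable]: "\<And>i. (\<lambda>\<omega>. b \<omega> (Suc i)) \<in> borel_measurable M"
    "\<And>i. (\<lambda>\<omega>. y \<omega> (Suc i)) \<in> borel_measurable M"
  shows "(\<lambda>\<omega>. wealth (b \<omega>) \<mu> (y \<omega>) t) \<in> borel_measurable M"
  by (induction t) (simp_all, measurable)

lemma borel_measurable_bet_fraction:
  assumes [measurable]: "m \<in> borel_measurable M" "v \<in> borel_measurable M"
  shows "(\<lambda>\<omega>. bet_fraction \<kappa> \<delta> (m \<omega>) (v \<omega>) \<mu>) \<in> borel_measurable M"
  unfolding bet_fraction_def clip_def Let_def by (cases "\<mu> = 0"; cases "\<mu> = 1") simp_all

lemma (in prob_space) expectation_square_le:
  fixes X :: "'a \<Rightarrow> real"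
  assumes "integrable M X" "integrable M (\<lambda>\<omega>. (X \<omega>)\<^sup>2)"
  shows "(expectation X)\<^sup>2 \<le> expectation (\<lambda>\<omega>. (X \<omega>)\<^sup>2)"
  using variance_positive[of X] variance_eq[OF assms] by simp

text \<open>The stream is described by independence, its range and its common first two moments;
  \<open>theorem1\<close> derives these from \<open>P\<close> and \<psi>. The range is imposed at
  every sample point, so the bounds on the wealth factors hold surely.\<close>

locale sim_to_real = prob_space \<Omega> for \<Omega> :: "'w measure" +
  fixes y :: "'w \<Rightarrow> nat \<Rightarrow> real" and \<mu>\<^sub>0 \<sigma>2 \<eta> \<kappa> \<delta> :: real
    and K :: nat and ms vs :: "nat \<Rightarrow> real"
  assumes indep: "indep_vars (\<lambda>_. borel) (\<lambda>s \<omega>. y \<omega> s) {1..}"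
    and range: "\<And>\<omega> s. \<omega> \<in> space \<Omega> \<Longrightarrow> y \<omega> (Suc s) \<in> {0..1}"
    and mean: "\<And>s. expectation (\<lambda>\<omega>. y \<omega> (Suc s)) = \<mu>\<^sub>0"
    and var: "\<And>s. expectation (\<lambda>\<omega>. (y \<omega> (Suc s) - \<mu>\<^sub>0)\<^sup>2) = \<sigma>2"
    and \<sigma>2_pos: "\<sigma>2 > 0" and K_pos: "K \<ge> 1"
    and ms: "\<And>k. k \<in> {1..K} \<Longrightarrow> ms k \<in> {0..1}"
    and vs: "\<And>k. k \<in> {1..K} \<Longrightarrow> vs k > 0"
    and \<eta>: "\<eta> > 0" and \<kappa>: "\<kappa> > 0" and \<delta>: "\<delta> \<in> {0<..<1}"
begin

abbreviation "vmin \<equiv> v_min K vs \<sigma>2"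
abbreviation "vmax \<equiv> v_max K vs \<sigma>2"
abbreviation "weight \<omega> s \<equiv> sim_weight K ms vs \<eta> (y \<omega>) (Suc s)"
abbreviation "kl k \<equiv> gauss_kl \<mu>\<^sub>0 \<sigma>2 (ms k) (vs k)"
abbreviation "moment_error \<omega> s \<equiv> (mix_mean K ms vs \<eta> (y \<omega>) (Suc s) - \<mu>\<^sub>0)\<^sup>2
  + (mix_var K ms vs \<eta> (y \<omega>) (Suc s) - \<sigma>2)\<^sup>2"
abbreviation "gain \<omega> s k \<equiv> ln (normal_density (ms k) (sqrt (vs k)) (y \<omega> (Suc s)))"

lemma vmin_pos: "0 < vmin"
  using \<sigma>2_pos vs by (auto simp: v_min_def Min_gr_iff)

lemma v_bounds: "vmin \<le> \<sigma>2" "\<sigma>2 \<le> vmax" "k \<in> {1..K} \<Longrightarrow> vmin \<le> vs k" "k \<in> {1..K} \<Longrightarrow> vs k \<le> vmax"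
  unfolding v_min_def v_max_def by (auto simp del: Min_insert Max_insert intro!: Min_le Max_ge)

lemma y_measurable [measurable]: "(\<lambda>\<omega>. y \<omega> (Suc s)) \<in> borel_measurable \<Omega>"
  using indep by (auto simp: indep_vars_def)

lemma y_measurable': "i \<in> {1..n} \<Longrightarrow> (\<lambda>\<omega>. y \<omega> i) \<in> borel_measurable \<Omega>"
  using y_measurable[of "i - 1"] by simp

lemma weight_measurable [measurable]: "(\<lambda>\<omega>. weight \<omega> s k) \<in> borel_measurable \<Omega>"
  by (rule borel_measurable_sim_weight) (rule y_measurable')

lemma weight_bounds: "0 \<le> weight \<omega> s k" "k \<in> {1..K} \<Longrightarrow> weight \<omega> s k \<le> 1"
  by (auto simp: sim_weight_nonneg intro: sim_weight_le_1)

lemma integrable_weight: "k \<in> {1..K} \<Longrightarrow> integrable \<Omega> (\<lambda>\<omega>. weight \<omega> s k)"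
  by (rule integrable_const_bound[where B = 1]) (use weight_bounds in auto)

text \<open>The weight factors through the rounds 1 to \<open>s\<close> and the observation through
  round \<open>Suc s\<close>. These index sets are disjoint, so the two restrictions of the stream
  are independent.\<close>

lemma indep_weight_y:
  "indep_var borel (\<lambda>\<omega>. weight \<omega> s k) borel (\<lambda>\<omega>. y \<omega> (Suc s))"
proof -
  let ?P = "\<lambda>A. Pi\<^sub>M A (\<lambda>_. borel :: real measure)"
  have "indep_var (?P {1..s}) (\<lambda>\<omega>. restrict (y \<omega>) {1..s}) (?P {Suc s}) (\<lambda>\<omega>. restrict (y \<omega>) {Suc s})"
    using indep_var_restrict[OF indep, of "{1..s}" "{Suc s}"] by auto
  then have "indep_var borel ((\<lambda>z. sim_weight K ms vs \<eta> z (Suc s) k) \<circ> (\<lambda>\<omega>. restrict (y \<omega>) {1..s}))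
      borel ((\<lambda>z. z (Suc s)) \<circ> (\<lambda>\<omega>. restrict (y \<omega>) {Suc s}))"
    by (rule indep_var_compose) (auto intro!: borel_measurable_sim_weight measurable_component_singleton)
  moreover have "weight \<omega> s k = sim_weight K ms vs \<eta> (restrict (y \<omega>) {1..s}) (Suc s) k" for \<omega>
    by (rule sim_weight_cong) simp
  ultimately show ?thesis by (simp add: comp_def)
qed

lemma integrable_y: "integrable \<Omega> (\<lambda>\<omega>. y \<omega> (Suc s))"
  by (rule integrable_const_bound[where B = 1]) (use range in auto)

lemma integrable_y_square: "integrable \<Omega> (\<lambda>\<omega>. (y \<omega> (Suc s) - c)\<^sup>2)"
proof -
  have "integrable \<Omega> (\<lambda>\<omega>. (y \<omega> (Suc s))\<^sup>2)"
    by (rule integrable_const_bound[where B = 1]) (use range in \<open>auto simp: abs_square_le_1\<close>)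
  then show ?thesis using integrable_y by (simp add: power2_diff)
qed

lemma expectation_y_square: "expectation (\<lambda>\<omega>. (y \<omega> (Suc s) - c)\<^sup>2) = \<sigma>2 + (\<mu>\<^sub>0 - c)\<^sup>2"
proof -
  have "(\<lambda>\<omega>. (y \<omega> (Suc s) - c)\<^sup>2)
      = (\<lambda>\<omega>. (y \<omega> (Suc s) - \<mu>\<^sub>0)\<^sup>2 + 2 * (\<mu>\<^sub>0 - c) * (y \<omega> (Suc s) - \<mu>\<^sub>0) + (\<mu>\<^sub>0 - c)\<^sup>2)"
    by (simp add: power2_eq_square algebra_simps)
  then show ?thesis
    using integrable_y integrable_y_square by (simp add: mean var prob_space)
qed

lemma gain_eq: "k \<in> {1..K} \<Longrightarrow> gain \<omega> s k = - ln (2 * pi * vs k) / 2 - (y \<omega> (Suc s) - ms k)\<^sup>2 / (2 * vs k)"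
  using vs by (simp add: ln_normal_density)

lemma integrable_gain: "k \<in> {1..K} \<Longrightarrow> integrable \<Omega> (\<lambda>\<omega>. gain \<omega> s k)"
  using integrable_y_square by (simp add: gain_eq)

text \<open>A Gaussian log score is quadratic in the observation, so its expectation sees only the
  first two moments of the stream, which may be far from Gaussian. It therefore equals the negative
  cross-entropy for \<open>N(\<mu>\<^sub>0, \<sigma>2)\<close>: minus the entropy of that law, minus
  the divergence.\<close>

lemma expectation_gain:
  assumes "k \<in> {1..K}"
  shows "expectation (\<lambda>\<omega>. gain \<omega> s k) = - ln (2 * pi * \<sigma>2) / 2 - 1 / 2 - kl k"
proof -
  have "expectation (\<lambda>\<omega>. gain \<omega> s k)
      = - ln (2 * pi * vs k) / 2 - (\<sigma>2 + (\<mu>\<^sub>0 - ms k)\<^sup>2) / (2 * vs k)"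
    using integrable_y_square assms
    by (simp add: gain_eq expectation_y_square prob_space)
  then show ?thesis
    using vs[OF assms] \<sigma>2_pos by (simp add: gauss_kl_def ln_mult ln_div field_simps)
qed

lemma weight_gain:
  assumes "k \<in> {1..K}"
  shows "integrable \<Omega> (\<lambda>\<omega>. weight \<omega> s k * gain \<omega> s k)"
    and "expectation (\<lambda>\<omega>. weight \<omega> s k * gain \<omega> s k)
      = expectation (\<lambda>\<omega>. weight \<omega> s k) * expectation (\<lambda>\<omega>. gain \<omega> s k)"
proof -
  have "indep_var borel ((\<lambda>p. p) \<circ> (\<lambda>\<omega>. weight \<omega> s k))
      borel ((\<lambda>z. ln (normal_density (ms k) (sqrt (vs k)) z)) \<circ> (\<lambda>\<omega>. y \<omega> (Suc s)))"
    by (rule indep_var_compose[OF indep_weight_y]) auto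
  then have "indep_var borel (\<lambda>\<omega>. weight \<omega> s k) borel (\<lambda>\<omega>. gain \<omega> s k)"
    by (simp add: comp_def)
  note this integrable_weight[OF assms] integrable_gain[OF assms]
  then show "integrable \<Omega> (\<lambda>\<omega>. weight \<omega> s k * gain \<omega> s k)"
    "expectation (\<lambda>\<omega>. weight \<omega> s k * gain \<omega> s k)
      = expectation (\<lambda>\<omega>. weight \<omega> s k) * expectation (\<lambda>\<omega>. gain \<omega> s k)"
    by (rule indep_var_integrable, rule indep_var_lebesgue_integral)
qed

text \<open>In expectation every gain is the constant \<open>c\<close> minus a divergence. The
  weights sum to 1, so \<open>c\<close> contributes \<open>t * c\<close> on both sides of the
  exponential weights bound and cancels; the change of sign turns a lower bound on gains into an
  upper bound on divergences.\<close>

lemma expected_divergence_le: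
  assumes "j \<in> {1..K}"
  shows "expectation (\<lambda>\<omega>. \<Sum>s<t. \<Sum>k=1..K. weight \<omega> s k * kl k)
    \<le> t * kl j + ln K / \<eta> + \<eta> * (b_score vmin vmax)\<^sup>2 / 8 * t"
proof -
  define c where "c = - ln (2 * pi * \<sigma>2) / 2 - 1 / 2"
  note gain = expectation_gain[folded c_def]
  define R where "R = ln K / \<eta> + \<eta> * (b_score vmin vmax)\<^sup>2 / 8 * t"
  note [simp] = integrable_weight weight_gain(1) integrable_gain
  have "expectation (\<lambda>\<omega>. (\<Sum>s<t. gain \<omega> s j) - R)
      \<le> expectation (\<lambda>\<omega>. \<Sum>s<t. \<Sum>k=1..K. weight \<omega> s k * gain \<omega> s k)"
  proof (rule integral_mono)
    fix \<omega> assume "\<omega> \<in> space \<Omega>"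
    then show "(\<Sum>s<t. gain \<omega> s j) - R \<le> (\<Sum>s<t. \<Sum>k=1..K. weight \<omega> s k * gain \<omega> s k)"
      using sim_weight_gain[OF \<eta> assms vmin_pos, of vs vmax ms t "y \<omega>"] ms range v_bounds
      by (simp add: R_def)
  next
    show "integrable \<Omega> (\<lambda>\<omega>. (\<Sum>s<t. gain \<omega> s j) - R)" using assms by simp
    show "integrable \<Omega> (\<lambda>\<omega>. \<Sum>s<t. \<Sum>k=1..K. weight \<omega> s k * gain \<omega> s k)"
      by (intro Bochner_Integration.integrable_sum weight_gain(1))
  qed
  moreover have "expectation (\<lambda>\<omega>. (\<Sum>s<t. gain \<omega> s j) - R) = t * (c - kl j) - R"
    using assms by (simp add: gain prob_space)
  \<comment> \<open>The gain may be replaced by its mean under the expectation, though not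
    pointwise, because it is independent of the weight of the same round.\<close>
  moreover have "expectation (\<lambda>\<omega>. \<Sum>s<t. \<Sum>k=1..K. weight \<omega> s k * gain \<omega> s k)
      = expectation (\<lambda>\<omega>. \<Sum>s<t. \<Sum>k=1..K. weight \<omega> s k * (c - kl k))"
  proof -
    have swap: "expectation (\<lambda>\<omega>. \<Sum>s<t. \<Sum>k=1..K. f \<omega> s k)
        = (\<Sum>s<t. \<Sum>k=1..K. expectation (\<lambda>\<omega>. f \<omega> s k))"
      if "\<And>s k. k \<in> {1..K} \<Longrightarrow> integrable \<Omega> (\<lambda>\<omega>. f \<omega> s k)" for f :: "'w \<Rightarrow> nat \<Rightarrow> nat \<Rightarrow> real"
      using that
      by (subst Bochner_Integration.integral_sum)
        (auto intro!: sum.cong Bochner_Integration.integral_sum Bochner_Integration.integrable_sum)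
    show ?thesis
      by (subst (1 2) swap)
        (auto simp: weight_gain(2) gain intro!: sum.cong integrable_mult_left)
  qed
  moreover have "(\<Sum>k=1..K. weight \<omega> s k * (c - kl k)) = c - (\<Sum>k=1..K. weight \<omega> s k * kl k)" for \<omega> s
    using sim_weight_sum[OF K_pos]
    by (simp only: right_diff_distrib sum_subtractf sum_distrib_right[symmetric] mult_1)
  then have "expectation (\<lambda>\<omega>. \<Sum>s<t. \<Sum>k=1..K. weight \<omega> s k * (c - kl k))
      = expectation (\<lambda>\<omega>. t * c - (\<Sum>s<t. \<Sum>k=1..K. weight \<omega> s k * kl k))"
    by (simp only: sum_subtractf) simp
  moreover have "\<dots> = t * c - expectation (\<lambda>\<omega>. \<Sum>s<t. \<Sum>k=1..K. weight \<omega> s k * kl k)"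
    by (subst Bochner_Integration.integral_diff)
      (auto simp: prob_space intro!: Bochner_Integration.integrable_sum integrable_mult_left integrable_weight)
  ultimately show ?thesis unfolding R_def by (simp only: right_diff_distrib)
qed

section \<open>Expected moment error\<close>

lemma mix_measurable [measurable]:
  "(\<lambda>\<omega>. mix_mean K ms vs \<eta> (y \<omega>) (Suc s)) \<in> borel_measurable \<Omega>"
  "(\<lambda>\<omega>. mix_var K ms vs \<eta> (y \<omega>) (Suc s)) \<in> borel_measurable \<Omega>"
  unfolding mix_mean_def mix_var_def by measurable

lemma moment_error_le:
  "moment_error \<omega> s \<le> c_mom vmax * (\<Sum>k=1..K. weight \<omega> s k * kl k)"
  using mixture_error_le[OF K_pos vs v_bounds(4) \<sigma>2_pos v_bounds(2)] by simp

lemma c_mom_nonneg: "0 \<le> c_mom vmax"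
  using v_bounds(2) \<sigma>2_pos by (simp add: c_mom_def)

lemma kl_nonneg: "k \<in> {1..K} \<Longrightarrow> 0 \<le> kl k"
  using vs \<sigma>2_pos by (simp add: gauss_kl_nonneg)

text \<open>A crude deterministic bound that provides integrability.\<close>

lemma moment_error_bounded: "moment_error \<omega> s \<le> c_mom vmax * (\<Sum>k=1..K. kl k)"
proof -
  have "(\<Sum>k=1..K. weight \<omega> s k * kl k) \<le> (\<Sum>k=1..K. 1 * kl k)"
    using weight_bounds kl_nonneg by (intro sum_mono mult_right_mono) auto
  then show ?thesis
    using c_mom_nonneg by (intro order_trans[OF moment_error_le] mult_left_mono) auto
qed

lemma integrable_moment_error: "integrable \<Omega> (\<lambda>\<omega>. moment_error \<omega> s)"
  by (rule integrable_const_bound[where B = "c_mom vmax * (\<Sum>k=1..K. kl k)"])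
    (use moment_error_bounded in auto)

lemma integrable_sqrt_moment_error: "integrable \<Omega> (\<lambda>\<omega>. sqrt (moment_error \<omega> s))"
  by (rule integrable_const_bound[where B = "sqrt (c_mom vmax * (\<Sum>k=1..K. kl k))"])
    (use moment_error_bounded in auto)

lemma expected_sqrt_moment_error_le:
  assumes "j \<in> {1..K}" "t \<ge> 1"
  shows "expectation (\<lambda>\<omega>. \<Sum>s<t. sqrt (moment_error \<omega> s))
    \<le> t * sqrt (c_mom vmax * (kl j + ln K / (\<eta> * t) + \<eta> * (b_score vmin vmax)\<^sup>2 / 8))"
proof -
  define X where "X \<omega> = (\<Sum>s<t. sqrt (moment_error \<omega> s))" for \<omega>
  \<comment> \<open>Cauchy-Schwarz over the rounds, at each sample point.\<close>
  have X_square: "(X \<omega>)\<^sup>2 \<le> t * (\<Sum>s<t. moment_error \<omega> s)" for \<omega>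
    using sum_squared_le_sum_of_squares[of "\<lambda>s. sqrt (moment_error \<omega> s)" "{..<t}"]
    by (simp add: X_def mult.commute)
  have [measurable]: "X \<in> borel_measurable \<Omega>" unfolding X_def[abs_def] by measurable
  have int: "integrable \<Omega> (\<lambda>\<omega>. t * (\<Sum>s<t. moment_error \<omega> s))"
    by (intro integrable_mult_right Bochner_Integration.integrable_sum integrable_moment_error)
  have int_square: "integrable \<Omega> (\<lambda>\<omega>. (X \<omega>)\<^sup>2)"
    by (rule Bochner_Integration.integrable_bound[OF int])
      (use X_square in \<open>auto intro!: AE_I2 order_trans[OF _ abs_ge_self]\<close>)
  have int_X: "integrable \<Omega> X"
    unfolding X_def[abs_def] by (intro Bochner_Integration.integrable_sum integrable_sqrt_moment_error)
  \<comment> \<open>Cauchy-Schwarz over the sample space. Passing to squares makes the bound linear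
    in the posterior divergence, whose expectation is controlled.\<close>
  have "(expectation X)\<^sup>2 \<le> expectation (\<lambda>\<omega>. (X \<omega>)\<^sup>2)"
    by (rule expectation_square_le[OF int_X int_square])
  also have "\<dots> \<le> expectation (\<lambda>\<omega>. t * (c_mom vmax * (\<Sum>s<t. \<Sum>k=1..K. weight \<omega> s k * kl k)))"
  proof (rule integral_mono[OF int_square])
    show "integrable \<Omega> (\<lambda>\<omega>. t * (c_mom vmax * (\<Sum>s<t. \<Sum>k=1..K. weight \<omega> s k * kl k)))"
      by (intro integrable_mult_right integrable_mult_left Bochner_Integration.integrable_sum integrable_weight)
    show "(X \<omega>)\<^sup>2 \<le> t * (c_mom vmax * (\<Sum>s<t. \<Sum>k=1..K. weight \<omega> s k * kl k))" for \<omega>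
    proof (rule order_trans[OF X_square])
      show "t * (\<Sum>s<t. moment_error \<omega> s)
          \<le> t * (c_mom vmax * (\<Sum>s<t. \<Sum>k=1..K. weight \<omega> s k * kl k))"
        unfolding sum_distrib_left[of "c_mom vmax" _ "{..<t}"]
        by (intro mult_left_mono sum_mono moment_error_le) auto
    qed
  qed
  also have "\<dots> = t * (c_mom vmax * expectation (\<lambda>\<omega>. \<Sum>s<t. \<Sum>k=1..K. weight \<omega> s k * kl k))"
    by simp
  also have "\<dots> \<le> t * (c_mom vmax * (t * kl j + ln K / \<eta> + \<eta> * (b_score vmin vmax)\<^sup>2 / 8 * t))"
    using expected_divergence_le[OF assms(1)] c_mom_nonneg by (intro mult_left_mono) auto
  \<comment> \<open>The factor \<open>t\<close> extracted here joins the one from Cauchy-Schwarz,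
    and the square root of their product is the final factor \<open>t\<close>.\<close>
  also have "t * kl j + ln K / \<eta> + \<eta> * (b_score vmin vmax)\<^sup>2 / 8 * t
      = t * (kl j + ln K / (\<eta> * t) + \<eta> * (b_score vmin vmax)\<^sup>2 / 8)"
    using assms \<eta> by (simp add: distrib_left)
  finally have "(expectation X)\<^sup>2
      \<le> (real t)\<^sup>2 * (c_mom vmax * (kl j + ln K / (\<eta> * t) + \<eta> * (b_score vmin vmax)\<^sup>2 / 8))"
    by (simp add: power2_eq_square mult_ac)
  then have "expectation X
      \<le> sqrt ((real t)\<^sup>2 * (c_mom vmax * (kl j + ln K / (\<eta> * t) + \<eta> * (b_score vmin vmax)\<^sup>2 / 8)))"
    by (rule real_le_rsqrt)
  then show ?thesis by (simp add: X_def[abs_def] real_sqrt_mult)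
qed

section \<open>Bounding, measuring and integrating the worst-candidate regret\<close>

abbreviation "pos_reg \<omega> \<equiv> pos_regret K ms vs \<eta> \<kappa> \<delta> \<mu>\<^sub>0 \<sigma>2 (y \<omega>)"
abbreviation "worst_reg \<omega> \<equiv> worst_regret K ms vs \<eta> \<kappa> \<delta> \<mu>\<^sub>0 \<sigma>2 (y \<omega>)"

lemma pos_regret_le:
  assumes "\<omega> \<in> space \<Omega>" "\<mu> \<in> {0..1}"
  shows "pos_reg \<omega> t \<mu> \<le> c_stab \<kappa> \<delta> vmin * (\<Sum>s<t. sqrt (moment_error \<omega> s))"
proof -
  have "wealth_regret K ms vs \<eta> \<kappa> \<delta> \<mu>\<^sub>0 \<sigma>2 (y \<omega>) t \<mu>
      \<le> c_stab \<kappa> \<delta> vmin * (\<Sum>s<t. sqrt (moment_error \<omega> s))"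
    unfolding sum_distrib_left using assms range K_pos v_bounds
    by (intro wealth_regret_le \<kappa> \<delta> vmin_pos mix_var_ge) auto
  then show ?thesis
    by (auto simp: pos_regret_def intro!: mult_nonneg_nonneg c_stab_nonneg sum_nonneg)
qed

lemma bdd_above_pos_regret: "\<omega> \<in> space \<Omega> \<Longrightarrow> bdd_above (pos_reg \<omega> t ` {0..1})"
  using pos_regret_le by (intro bdd_aboveI2)

lemma worst_regret_nonneg:
  assumes "\<omega> \<in> space \<Omega>"
  shows "0 \<le> worst_reg \<omega> t"
  unfolding worst_regret_def
  by (rule cSUP_upper2[OF bdd_above_pos_regret[OF assms], of 0]) (auto simp: pos_regret_def)

lemma worst_regret_le:
  assumes "\<omega> \<in> space \<Omega>"
  shows "worst_reg \<omega> t \<le> c_stab \<kappa> \<delta> vmin * (\<Sum>s<t. sqrt (moment_error \<omega> s))"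
  unfolding worst_regret_def using pos_regret_le[OF assms] by (intro cSUP_least) auto

lemma continuous_on_pos_regret:
  assumes "\<omega> \<in> space \<Omega>"
  shows "continuous_on {0<..<1} (pos_reg \<omega> t)"
proof -
  have "0 < mix_var K ms vs \<eta> (y \<omega>) s" for s
    using mix_var_ge[OF K_pos, where vs = vs and a = vmin] v_bounds(3) vmin_pos by (force intro: less_le_trans)
  then show ?thesis
    unfolding pos_regret_def[abs_def] wealth_regret_def kelly_wealth_def sim_wealth_def
    by (intro continuous_intros continuous_on_ln_wealth \<delta> range assms \<sigma>2_pos)
qed

text \<open>Continuity in the candidate reduces the supremum to the countably many rational
  candidates.\<close>

lemma worst_regret_measurable: "(\<lambda>\<omega>. worst_reg \<omega> t) \<in> borel_measurable \<Omega>"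
proof -
  have [measurable]: "(\<lambda>\<omega>. pos_reg \<omega> t \<mu>) \<in> borel_measurable \<Omega>" for \<mu>
    unfolding pos_regret_def wealth_regret_def kelly_wealth_def sim_wealth_def
    by (intro borel_measurable_max borel_measurable_diff borel_measurable_ln
        borel_measurable_wealth borel_measurable_bet_fraction) measurable
  have "(\<lambda>\<omega>. SUP \<mu>\<in>\<rat> \<inter> {0..1}. pos_reg \<omega> t \<mu>) \<in> borel_measurable \<Omega>"
  proof (rule borel_measurable_cSUP)
    show "countable (\<rat> \<inter> {0..1::real})" by (intro countable_Int1 countable_rat)
    show "bdd_above (pos_reg \<omega> t ` (\<rat> \<inter> {0..1}))" if "\<omega> \<in> space \<Omega>" for \<omega>
      using bdd_above_pos_regret[OF that] by (rule bdd_above_mono) auto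
  qed measurable
  then show ?thesis
    by (rule measurable_cong[THEN iffD1, rotated])
      (simp add: worst_regret_def SUP_unit_interval_rational continuous_on_pos_regret bdd_above_pos_regret)
qed

lemma worst_regret:
  assumes "t \<ge> 1"
  shows "integrable \<Omega> (\<lambda>\<omega>. worst_reg \<omega> t)"
    and "expectation (\<lambda>\<omega>. worst_reg \<omega> t) / t \<le> c_stab \<kappa> \<delta> vmin
      * sqrt (c_mom vmax * (eps_bank K ms vs \<mu>\<^sub>0 \<sigma>2 + ln K / (\<eta> * t)
                            + \<eta> * (b_score vmin vmax)\<^sup>2 / 8))"
proof -
  have int: "integrable \<Omega> (\<lambda>\<omega>. c_stab \<kappa> \<delta> vmin * (\<Sum>s<t. sqrt (moment_error \<omega> s)))"
    by (intro integrable_mult_right Bochner_Integration.integrable_sum integrable_sqrt_moment_error)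
  show int': "integrable \<Omega> (\<lambda>\<omega>. worst_reg \<omega> t)"
    by (rule Bochner_Integration.integrable_bound[OF int worst_regret_measurable])
      (use worst_regret_le worst_regret_nonneg in \<open>auto intro!: AE_I2 order_trans[OF _ abs_ge_self]\<close>)
  \<comment> \<open>The bound on the expected moment error holds against every simulator
    \<open>j\<close>; one that attains the minimum in \<open>eps_bank\<close> is chosen.\<close>
  have "eps_bank K ms vs \<mu>\<^sub>0 \<sigma>2 \<in> kl ` {1..K}"
    unfolding eps_bank_def gauss_kl_def using K_pos by (intro Min_in) auto
  then obtain j where j: "j \<in> {1..K}" "eps_bank K ms vs \<mu>\<^sub>0 \<sigma>2 = kl j" by auto
  have "expectation (\<lambda>\<omega>. worst_reg \<omega> t)
      \<le> expectation (\<lambda>\<omega>. c_stab \<kappa> \<delta> vmin * (\<Sum>s<t. sqrt (moment_error \<omega> s)))"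
    by (rule integral_mono[OF int' int worst_regret_le])
  also have "\<dots> = c_stab \<kappa> \<delta> vmin * expectation (\<lambda>\<omega>. \<Sum>s<t. sqrt (moment_error \<omega> s))"
    by simp
  also have "\<dots> \<le> c_stab \<kappa> \<delta> vmin
      * (t * sqrt (c_mom vmax * (kl j + ln K / (\<eta> * t) + \<eta> * (b_score vmin vmax)\<^sup>2 / 8)))"
    by (intro mult_left_mono expected_sqrt_moment_error_le j assms c_stab_nonneg)
  finally show "expectation (\<lambda>\<omega>. worst_reg \<omega> t) / t \<le> c_stab \<kappa> \<delta> vmin
      * sqrt (c_mom vmax * (eps_bank K ms vs \<mu>\<^sub>0 \<sigma>2 + ln K / (\<eta> * t)
                            + \<eta> * (b_score vmin vmax)\<^sup>2 / 8))"
    using assms by (simp add: j(2) divide_le_eq mult_ac)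
qed

end

theorem theorem1:
  fixes P :: "'x measure" and \<psi> :: "'x \<Rightarrow> real"
    and \<Omega> :: "'w measure" and x :: "nat \<Rightarrow> 'w \<Rightarrow> 'x" and y :: "'w \<Rightarrow> nat \<Rightarrow> real"
    and \<mu>\<^sub>0 \<sigma>2 \<eta> \<kappa> \<delta> :: real
    and K T t :: nat and ms vs :: "nat \<Rightarrow> real"
  assumes "prob_space P"
    and "\<psi> \<in> borel_measurable P" and "\<And>z. z \<in> space P \<Longrightarrow> \<psi> z \<in> {0..1}"
    and "prob_space \<Omega>"
    and "prob_space.indep_vars \<Omega> (\<lambda>_. P) x {1..}"
    and "\<And>s. s \<ge> 1 \<Longrightarrow> distr \<Omega> P (x s) = P"
    and y: "y = (\<lambda>\<omega> s. \<psi> (x s \<omega>))"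
    and mean: "\<mu>\<^sub>0 = (\<integral>z. \<psi> z \<partial>P)"
    and var: "\<sigma>2 = (\<integral>z. (\<psi> z - \<mu>\<^sub>0)\<^sup>2 \<partial>P)" and "\<sigma>2 > 0"
    and "K \<ge> 1"
    and "\<And>k. k \<in> {1..K} \<Longrightarrow> ms k \<in> {0..1}" and "\<And>k. k \<in> {1..K} \<Longrightarrow> vs k > 0"
    and "\<eta> > 0" and "\<kappa> \<in> {0<..1}" and "\<delta> \<in> {0<..<1}"
    and "t \<in> {1..T}"
  shows "(\<forall>\<omega>\<in>space \<Omega>. bdd_above (pos_regret K ms vs \<eta> \<kappa> \<delta> \<mu>\<^sub>0 \<sigma>2 (y \<omega>) t ` {0..1}))
    \<and> integrable \<Omega> (\<lambda>\<omega>. worst_regret K ms vs \<eta> \<kappa> \<delta> \<mu>\<^sub>0 \<sigma>2 (y \<omega>) t)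
    \<and> (\<integral>\<omega>. worst_regret K ms vs \<eta> \<kappa> \<delta> \<mu>\<^sub>0 \<sigma>2 (y \<omega>) t \<partial>\<Omega>) / real t
      \<le> c_stab \<kappa> \<delta> (v_min K vs \<sigma>2)
         * sqrt (c_mom (v_max K vs \<sigma>2)
             * (eps_bank K ms vs \<mu>\<^sub>0 \<sigma>2 + ln (real K) / (\<eta> * real t)
                + \<eta> * (b_score (v_min K vs \<sigma>2) (v_max K vs \<sigma>2))\<^sup>2 / 8))"
proof -
  interpret \<Omega>: prob_space \<Omega> by fact
  have x_measurable: "x s \<in> measurable \<Omega> P" if "s \<ge> 1" for s
    using assms(5) that by (auto simp: \<Omega>.indep_vars_def)
  \<comment> \<open>Change of variables under the law of \<open>x (Suc s)\<close>; it is applied to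
    the identity for the mean and to the centred square for the variance.\<close>
  have transfer: "(\<integral>\<omega>. f (\<psi> (x (Suc s) \<omega>)) \<partial>\<Omega>) = (\<integral>z. f (\<psi> z) \<partial>P)"
    if "f \<in> borel_measurable borel" for f :: "real \<Rightarrow> real" and s
  proof -
    have "(\<integral>z. f (\<psi> z) \<partial>P) = (\<integral>z. f (\<psi> z) \<partial>distr \<Omega> P (x (Suc s)))"
      by (simp add: assms(6))
    also have "\<dots> = (\<integral>\<omega>. f (\<psi> (x (Suc s) \<omega>)) \<partial>\<Omega>)"
      using x_measurable that assms(2) by (intro integral_distr) auto
    finally show ?thesis by simp
  qed
  interpret sim_to_real \<Omega> y \<mu>\<^sub>0 \<sigma>2 \<eta> \<kappa> \<delta> K ms vs
  proof
    show "\<Omega>.indep_vars (\<lambda>_. borel) (\<lambda>s \<omega>. y \<omega> s) {1..}"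
      unfolding y by (rule \<Omega>.indep_vars_compose2[OF assms(5,2)])
    show "y \<omega> (Suc s) \<in> {0..1}" if "\<omega> \<in> space \<Omega>" for \<omega> s
      unfolding y using measurable_space[OF x_measurable that] by (intro assms(3)) auto
    show "\<Omega>.expectation (\<lambda>\<omega>. y \<omega> (Suc s)) = \<mu>\<^sub>0" for s
      using transfer[of "\<lambda>r. r" s] by (simp add: y mean)
    show "\<Omega>.expectation (\<lambda>\<omega>. (y \<omega> (Suc s) - \<mu>\<^sub>0)\<^sup>2) = \<sigma>2" for s
      using transfer[of "\<lambda>r. (r - \<mu>\<^sub>0)\<^sup>2" s] by (simp add: y var)
  qed (use assms in auto)
  have "t \<ge> 1" using \<open>t \<in> {1..T}\<close> by simp
  then show ?thesis by (intro conjI ballI bdd_above_pos_regret worst_regret)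
qed

end
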